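(* Let $n\ge2$, let $f:\mathbb{R}\to\mathbb{R}$ be of class $C^1$, and let $r(u,t)$, $u\in\mathbb{S}^{n-1}$, evolve under the flow $r_t=f(r)$, where $r(\cdot,0)$ is a $C^3$ function. Then the total number $T$ of spatial critical points of the function $u\mapsto r(u,t)$ on $\mathbb{S}^{n-1}$ (the sum of the numbers of local minima, local maxima and saddles) does not change in time.
   Context: The flow $r_t=f(r)$ is a family of decoupled ordinary differential equations: for each fixed $u\in\mathbb{S}^{n-1}$, $t\mapsto r(u,t)$ solves $r_t(u,t)=f(r(u,t))$; $t$ ranges over a time interval containing $0$ on which the solution exists for every $u$. Here $r(u,t)$ is the distance of the evolving surface from the origin in direction $u$. A spatial critical point at time $t$ is a point of $\mathbb{S}^{n-1}$ where the differential of $r(\cdot,t)$ with respect to $u$ vanishes; a saddle is a critical point that is neither a local minimum nor a local maximum. *)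

theory Defs
  imports "HOL-Analysis.Analysis"
begin

text \<open>Meant for open \<open>U\<close>, where derivatives at points of \<open>U\<close> do not depend on the values of
  \<open>g\<close> outside \<open>U\<close>; \<open>frechet_derivative g (at x) (axis i 1)\<close> is the \<open>i\<close>-th partial derivative.\<close>

fun Ck_on_open :: "nat \<Rightarrow> (real ^ 'n) set \<Rightarrow> (real ^ 'n \<Rightarrow> real) \<Rightarrow> bool" where
  "Ck_on_open 0 U g \<longleftrightarrow> continuous_on U g"
| "Ck_on_open (Suc k) U g \<longleftrightarrow>
     (\<forall>x\<in>U. g differentiable (at x)) \<and>
     (\<forall>i. Ck_on_open k U (\<lambda>x. frechet_derivative g (at x) (axis i 1)))"

text \<open>A function on a subset (here: the sphere) is of class \<open>C\<^sup>k\<close> if near each point of the subset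
  it is the restriction of a \<open>C\<^sup>k\<close> function on an open subset of the ambient space.\<close>

definition Ck_on :: "nat \<Rightarrow> (real ^ 'n) set \<Rightarrow> (real ^ 'n \<Rightarrow> real) \<Rightarrow> bool" where
  "Ck_on k S f \<longleftrightarrow>
     (\<forall>x\<in>S. \<exists>U g. open U \<and> x \<in> U \<and> Ck_on_open k U g \<and> (\<forall>y\<in>S \<inter> U. g y = f y))"

text \<open>The tangent space of the unit sphere at \<open>u\<close> is the orthogonal complement of \<open>u\<close>. A derivative
  \<open>D\<close> within the sphere is determined only on that space (its value on the normal \<open>u\<close> is
  arbitrary), and its restriction to that space is the differential of the function on the sphere.\<close>

definition sphere_critical_points :: "(real ^ 'n \<Rightarrow> real) \<Rightarrow> (real ^ 'n) set" where
  "sphere_critical_points \<rho> =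
     {u \<in> sphere 0 1. \<exists>D. (\<rho> has_derivative D) (at u within sphere 0 1) \<and>
                          (\<forall>h. h \<bullet> u = 0 \<longrightarrow> D h = 0)}"

definition sphere_local_minima :: "(real ^ 'n \<Rightarrow> real) \<Rightarrow> (real ^ 'n) set" where
  "sphere_local_minima \<rho> =
     {u \<in> sphere 0 1. \<forall>\<^sub>F v in at u within sphere 0 1. \<rho> u \<le> \<rho> v}"

definition sphere_local_maxima :: "(real ^ 'n \<Rightarrow> real) \<Rightarrow> (real ^ 'n) set" where
  "sphere_local_maxima \<rho> =
     {u \<in> sphere 0 1. \<forall>\<^sub>F v in at u within sphere 0 1. \<rho> v \<le> \<rho> u}"

definition sphere_saddles :: "(real ^ 'n \<Rightarrow> real) \<Rightarrow> (real ^ 'n) set" where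
  "sphere_saddles \<rho> =
     sphere_critical_points \<rho> - sphere_local_minima \<rho> - sphere_local_maxima \<rho>"

text \<open>One-sided derivatives are used at end points of \<open>I\<close> that belong to \<open>I\<close>.\<close>

definition evolves_under :: "(real \<Rightarrow> real) \<Rightarrow> real set \<Rightarrow> (real ^ 'n \<Rightarrow> real \<Rightarrow> real) \<Rightarrow> bool" where
  "evolves_under f I r \<longleftrightarrow>
     (\<forall>u\<in>sphere 0 1. \<forall>t\<in>I. (r u has_real_derivative f (r u t)) (at t within I))"

end

theory Submission
  imports Defs
begin

text \<open>The equations for different directions are decoupled, so the value at time \<open>t\<close> is obtained from
  the value at time \<open>s\<close> by one fixed function of a real variable, the flow map of \<open>p' = f p\<close>. As \<open>f\<close> is
  of class \<open>C\<^sup>1\<close>, the flow map is differentiable. By the chain rule, differentiability of \<open>r(\<cdot>,s)\<close> at a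
  direction \<open>u\<close> passes to \<open>r(\<cdot>,t)\<close>, and the differential is only multiplied by a constant. Hence each
  point critical at time \<open>s\<close> is critical at time \<open>t\<close>. Since \<open>s\<close> and \<open>t\<close> can be exchanged, the sets of
  critical points are not merely equinumerous but equal.

  The differentiability of the flow map along an orbit \<open>x\<close> is \<open>flow_linearisation\<close>. If \<open>y\<close> is another
  orbit, divide \<open>y - x\<close> by the solution \<open>w\<close> of the linearised equation \<open>w' = f'(x) w\<close>, \<open>w 0 = 1\<close>. The
  quotient \<open>z\<close> would be constant if \<open>f\<close> were affine; in general, \<open>\<bar>z'\<bar> \<le> e \<bar>z\<bar>\<close> with \<open>e\<close> as small as one
  likes as long as \<open>y\<close> stays close to \<open>x\<close>. So \<open>z\<close> grows by at most a bounded factor, which first shows that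
  an orbit starting close to \<open>x\<close> stays close, and then that \<open>z\<close> is almost constant. The result transfers
  to functions on the sphere in \<open>evolves_under_transfers_derivative\<close>.

  For the decomposition of the number of critical points, local extrema of a differentiable function are
  critical, as one sees along great circles. Hence the critical set is the union of minima, maxima and
  saddles, and only minima and maxima can overlap. A point in the overlap has a neighbourhood on which the
  function is constant. The sphere has no isolated points when \<open>n \<ge> 2\<close>, so then there are infinitely
  many critical points, and for infinite sets the union and the disjoint sum have the same cardinality.\<close>

section \<open>Differentiability of the flow of a scalar equation\<close>

text \<open>Gronwall's inequality in differential form; squaring \<open>z\<close> removes the absolute value, and
  \<open>z\<^sup>2\<close> divided by the expected growth is nonincreasing.\<close>

lemma exponential_growth_bound:
  fixes z :: "real \<Rightarrow> real"
  assumes "0 \<le> T" and cont: "continuous_on {0..T} z"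
    and deriv: "\<And>\<tau>. 0 < \<tau> \<Longrightarrow> \<tau> < T \<Longrightarrow> (z has_real_derivative z' \<tau>) (at \<tau>)"
    and bound: "\<And>\<tau>. 0 < \<tau> \<Longrightarrow> \<tau> < T \<Longrightarrow> \<bar>z' \<tau>\<bar> \<le> e * \<bar>z \<tau>\<bar>"
  shows "\<bar>z T\<bar> \<le> exp (e * T) * \<bar>z 0\<bar>"
proof -
  define E where "E \<tau> = (z \<tau>)\<^sup>2 * exp (- (2 * e) * \<tau>)" for \<tau>
  have "E T \<le> E 0"
  proof (rule DERIV_nonpos_imp_decreasing_open[OF \<open>0 \<le> T\<close>])
    fix \<tau> assume \<tau>: "0 < \<tau>" "\<tau> < T"
    have "(E has_real_derivative (2 * z \<tau> * z' \<tau> - 2 * e * (z \<tau>)\<^sup>2) * exp (- (2 * e) * \<tau>)) (at \<tau>)"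
      unfolding E_def
      by (rule derivative_eq_intros deriv[OF \<tau>] refl | simp add: algebra_simps power2_eq_square)+
    moreover have "z \<tau> * z' \<tau> \<le> e * (z \<tau>)\<^sup>2"
    proof -
      have "z \<tau> * z' \<tau> \<le> \<bar>z \<tau>\<bar> * \<bar>z' \<tau>\<bar>"
        by (metis abs_ge_self abs_mult)
      also have "\<dots> \<le> \<bar>z \<tau>\<bar> * (e * \<bar>z \<tau>\<bar>)"
        using bound[OF \<tau>] by (intro mult_left_mono) auto
      also have "\<dots> = e * (z \<tau>)\<^sup>2"
        by (simp add: power2_eq_square)
      finally show ?thesis .
    qed
    ultimately show "\<exists>d. (E has_real_derivative d) (at \<tau>) \<and> d \<le> 0"
      by (intro exI[of _ "(2 * z \<tau> * z' \<tau> - 2 * e * (z \<tau>)\<^sup>2) * exp (- (2 * e) * \<tau>)"])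
         (auto intro!: mult_nonpos_nonneg)
  next
    show "continuous_on {0..T} E"
      unfolding E_def by (intro continuous_intros cont)
  qed
  then have "(z T)\<^sup>2 * exp (- (2 * e) * T) * exp (2 * e * T) \<le> (z 0)\<^sup>2 * exp (2 * e * T)"
    by (simp add: E_def)
  then have "(z T)\<^sup>2 \<le> (exp (e * T) * \<bar>z 0\<bar>)\<^sup>2"
    by (simp add: power_mult_distrib mult_ac flip: exp_add exp_of_nat_mult)
  then show ?thesis
    by (simp add: abs_le_square_iff[symmetric])
qed

text \<open>The remainder is \<open>f' \<xi> - f' q\<close> times \<open>p - q\<close> for an intermediate \<open>\<xi>\<close>, and \<open>f'\<close> is uniformly
  continuous on bounded sets.\<close>

lemma C1_uniform_linearisation:
  fixes f f' :: "real \<Rightarrow> real"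
  assumes deriv: "\<And>p. (f has_real_derivative f' p) (at p)"
    and cont: "continuous_on UNIV f'"
    and "compact C" "0 < e"
  obtains d where "0 < d"
    "\<And>p q. q \<in> C \<Longrightarrow> \<bar>p - q\<bar> < d \<Longrightarrow> \<bar>f p - f q - f' q * (p - q)\<bar> \<le> e * \<bar>p - q\<bar>"
proof -
  obtain R where R: "\<And>q. q \<in> C \<Longrightarrow> \<bar>q\<bar> \<le> R"
    using compact_imp_bounded[OF \<open>compact C\<close>] by (auto simp: bounded_iff)
  \<comment> \<open>The radius is enlarged by 1 because the intermediate point need not lie in \<open>C\<close>.\<close>
  have "uniformly_continuous_on (cball 0 (R + 1)) f'"
    by (intro compact_uniformly_continuous continuous_on_subset[OF cont]) auto
  then obtain d where d: "0 < d"
    "\<And>a b. a \<in> cball 0 (R + 1) \<Longrightarrow> b \<in> cball 0 (R + 1) \<Longrightarrow> \<bar>b - a\<bar> < d \<Longrightarrow> \<bar>f' b - f' a\<bar> < e"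
    using \<open>0 < e\<close> unfolding uniformly_continuous_on_def dist_real_def by metis
  show ?thesis
  proof (rule that[of "min d 1"])
    fix p q assume q: "q \<in> C" and pq: "\<bar>p - q\<bar> < min d 1"
    have "\<exists>\<xi>. \<bar>\<xi> - q\<bar> \<le> \<bar>p - q\<bar> \<and> f p - f q = f' \<xi> * (p - q)"
    proof (cases p q rule: linorder_cases)
      case less
      then show ?thesis
        using MVT2[OF less deriv] by (smt (verit) mult.commute minus_diff_eq mult_minus_left)
    next
      case greater
      then show ?thesis
        using MVT2[OF greater deriv] by (smt (verit) mult.commute)
    qed auto
    then obtain \<xi> where \<xi>: "\<bar>\<xi> - q\<bar> \<le> \<bar>p - q\<bar>" "f p - f q = f' \<xi> * (p - q)"
      by blast
    have "\<bar>f' \<xi> - f' q\<bar> < e"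
      using \<xi>(1) pq R[OF q] by (intro d(2)) auto
    then have "\<bar>f' \<xi> - f' q\<bar> * \<bar>p - q\<bar> \<le> e * \<bar>p - q\<bar>"
      by (intro mult_right_mono) auto
    then show "\<bar>f p - f q - f' q * (p - q)\<bar> \<le> e * \<bar>p - q\<bar>"
      by (simp add: \<xi>(2) abs_mult left_diff_distrib[symmetric])
  qed (use d in auto)
qed

text \<open>This says that the flow map from time \<open>0\<close> to time \<open>T\<close> has derivative \<open>c\<close> at \<open>x 0\<close>. It is stated
  with orbits instead of a flow map because other orbits may fail to exist up to time \<open>T\<close>; the set of
  initial values from which they do exist need not be specified.\<close>

lemma flow_linearisation:
  fixes f f' x :: "real \<Rightarrow> real"
  assumes deriv: "\<And>p. (f has_real_derivative f' p) (at p)"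
    and cont: "continuous_on UNIV f'"
    and "0 \<le> T"
    and x: "\<And>\<tau>. \<tau> \<in> {0..T} \<Longrightarrow> (x has_real_derivative f (x \<tau>)) (at \<tau> within {0..T})"
  obtains c where
    "\<And>e. 0 < e \<Longrightarrow> \<exists>d>0. \<forall>y.
       (\<forall>\<tau>\<in>{0..T}. (y has_real_derivative f (y \<tau>)) (at \<tau> within {0..T})) \<longrightarrow>
       \<bar>y 0 - x 0\<bar> < d \<longrightarrow> \<bar>y T - x T - c * (y 0 - x 0)\<bar> \<le> e * \<bar>y 0 - x 0\<bar>"
proof -
  have cont_sol: "continuous_on {0..T} y"
    if "\<forall>\<tau>\<in>{0..T}. (y has_real_derivative f (y \<tau>)) (at \<tau> within {0..T})" for y
    using that by (meson DERIV_continuous continuous_on_eq_continuous_within)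
  have contx: "continuous_on {0..T} x"
    using x by (intro cont_sol) auto
  have contf'x: "continuous_on {0..T} (\<lambda>\<tau>. f' (x \<tau>))"
    by (rule continuous_on_compose2[OF cont contx]) auto
  \<comment> \<open>The solution of the linearised equation along \<open>x\<close>; the required constant is its value at \<open>T\<close>.\<close>
  define w where "w \<tau> = exp (integral {0..\<tau>} (\<lambda>\<sigma>. f' (x \<sigma>)))" for \<tau>
  have w_pos: "0 < w \<tau>" and w_nz: "w \<tau> \<noteq> 0" for \<tau>
    by (simp_all add: w_def)
  have w0: "w 0 = 1"
    by (simp add: w_def)
  have w': "(w has_real_derivative f' (x \<tau>) * w \<tau>) (at \<tau> within {0..T})" if "\<tau> \<in> {0..T}" for \<tau>
    unfolding w_def
    by (rule derivative_eq_intros integral_has_real_derivative[OF contf'x that] refl | simp)+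
  have contw: "continuous_on {0..T} w"
    using w' by (meson DERIV_continuous continuous_on_eq_continuous_within)
  obtain W where W: "\<And>\<tau>. \<tau> \<in> {0..T} \<Longrightarrow> w \<tau> \<le> W"
    using compact_imp_bounded[OF compact_continuous_image[OF contw compact_Icc]]
    unfolding bounded_iff real_norm_def by (meson abs_le_D1 imageI)
  have W1: "1 \<le> W"
    using W[of 0] \<open>0 \<le> T\<close> by (simp add: w0)
  show ?thesis
  proof (rule that[of "w T"])
    fix e :: real assume "0 < e"
    \<comment> \<open>At the end \<open>\<bar>y T - x T - w T * (y 0 - x 0)\<bar>\<close> is at most \<open>e' * (W * exp T * T) * \<bar>y 0 - x 0\<bar>\<close>.
      The summand 1 makes \<open>M\<close> positive also for \<open>T = 0\<close>, and \<open>e' \<le> 1\<close> makes the growth factor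
      \<open>exp T\<close> independent of \<open>e'\<close>.\<close>
    define M where "M = W * exp T * T + 1"
    have M: "0 < M" "W * exp T * T \<le> M"
      using W1 \<open>0 \<le> T\<close> by (auto simp: M_def add_nonneg_pos)
    define e' where "e' = min 1 (e / M)"
    have e': "0 < e'" "e' \<le> 1" "e' * M \<le> e"
      using \<open>0 < e\<close> M(1) by (auto simp: e'_def min_def field_simps)
    obtain \<eta> where \<eta>: "0 < \<eta>"
      "\<And>p q. q \<in> x ` {0..T} \<Longrightarrow> \<bar>p - q\<bar> < \<eta> \<Longrightarrow> \<bar>f p - f q - f' q * (p - q)\<bar> \<le> e' * \<bar>p - q\<bar>"
      using C1_uniform_linearisation[OF deriv cont compact_continuous_image[OF contx compact_Icc] e'(1)]
      by metis
    define d where "d = \<eta> / (W * exp T)"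
    have "0 < d"
      using \<eta>(1) W1 by (simp add: d_def)
    moreover have "\<bar>y T - x T - w T * (y 0 - x 0)\<bar> \<le> e * \<bar>y 0 - x 0\<bar>"
      if y: "\<forall>\<tau>\<in>{0..T}. (y has_real_derivative f (y \<tau>)) (at \<tau> within {0..T})"
        and close: "\<bar>y 0 - x 0\<bar> < d" for y
    proof -
      define z where "z \<tau> = (y \<tau> - x \<tau>) / w \<tau>" for \<tau>
      define z' where "z' \<tau> = (f (y \<tau>) - f (x \<tau>) - f' (x \<tau>) * (y \<tau> - x \<tau>)) / w \<tau>" for \<tau>
      have z0: "z 0 = y 0 - x 0"
        by (simp add: z_def w0)
      have yx: "y \<tau> - x \<tau> = w \<tau> * z \<tau>" for \<tau>
        using w_nz by (simp add: z_def)
      have contz: "continuous_on {0..T} z"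
        unfolding z_def by (intro continuous_intros cont_sol[OF y] contx contw) (simp add: w_nz)
      have z': "(z has_real_derivative z' \<tau>) (at \<tau>)" if "0 < \<tau>" "\<tau> < T" for \<tau>
      proof -
        have \<tau>: "\<tau> \<in> {0..T}" and at: "at \<tau> within {0..T} = at \<tau>"
          using that by (auto intro: at_within_Icc_at)
        have "(z has_real_derivative
            ((f (y \<tau>) - f (x \<tau>)) * w \<tau> - (y \<tau> - x \<tau>) * (f' (x \<tau>) * w \<tau>)) / (w \<tau> * w \<tau>)) (at \<tau>)"
          unfolding z_def at[symmetric]
          by (intro DERIV_divide DERIV_diff w' x w_nz \<tau> y[rule_format])
        then show ?thesis
          by (rule DERIV_cong) (use w_nz[of \<tau>] in \<open>simp add: z'_def field_simps\<close>)
      qed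
      have z'_bound: "\<bar>z' \<tau>\<bar> \<le> e' * \<bar>z \<tau>\<bar>" if "0 < \<tau>" "\<tau> < T" "\<bar>y \<tau> - x \<tau>\<bar> < \<eta>" for \<tau>
        using \<eta>(2)[of "x \<tau>" "y \<tau>"] that w_pos[of \<tau>]
        by (simp add: z_def z'_def abs_divide divide_right_mono)
      have growth: "\<bar>z \<sigma>\<bar> \<le> exp T * \<bar>y 0 - x 0\<bar>"
        if \<sigma>: "\<sigma> \<in> {0..T}" and tube: "\<And>\<tau>. 0 < \<tau> \<Longrightarrow> \<tau> < \<sigma> \<Longrightarrow> \<bar>y \<tau> - x \<tau>\<bar> < \<eta>" for \<sigma>
      proof -
        have "\<bar>z \<sigma>\<bar> \<le> exp (e' * \<sigma>) * \<bar>z 0\<bar>"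
          using \<sigma> tube
          by (intro exponential_growth_bound[where z' = z'] continuous_on_subset[OF contz]
              z' z'_bound) auto
        also have "\<dots> \<le> exp T * \<bar>z 0\<bar>"
          using e' \<sigma> mult_mono[of e' 1 \<sigma> T] by (intro mult_right_mono) auto
        finally show ?thesis
          by (simp add: z0)
      qed
      \<comment> \<open>At the first time \<open>\<sigma>\<close> of leaving the \<open>\<eta>\<close>-tube about \<open>x\<close> the growth estimate still applies, and by the choice
        of \<open>d\<close> it puts \<open>y \<sigma>\<close> strictly inside.\<close>
      have stay: "\<bar>y \<tau> - x \<tau>\<bar> < \<eta>" if \<tau>: "\<tau> \<in> {0..T}" for \<tau>
      proof (rule ccontr)
        assume exit: "\<not> \<bar>y \<tau> - x \<tau>\<bar> < \<eta>"
        define X where "X = {\<tau>\<in>{0..T}. \<eta> \<le> \<bar>y \<tau> - x \<tau>\<bar>}"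
        have "continuous_on {0..T} (\<lambda>\<tau>. \<bar>y \<tau> - x \<tau>\<bar>)"
          by (intro continuous_intros cont_sol[OF y] contx)
        then have "closed X"
          unfolding X_def
          by (rule continuous_on_closed_Collect_le[OF continuous_on_const]) simp
        then have "compact ({0..T} \<inter> X)"
          by (rule compact_Int_closed[OF compact_Icc])
        also have "{0..T} \<inter> X = X"
          by (auto simp: X_def)
        finally have "compact X" .
        moreover have "X \<noteq> {}"
          using \<tau> exit by (auto simp: X_def)
        ultimately obtain \<sigma> where \<sigma>: "\<sigma> \<in> X" "\<And>\<tau>. \<tau> \<in> X \<Longrightarrow> \<sigma> \<le> \<tau>"
          by (meson compact_attains_inf)
        have \<sigma>T: "\<sigma> \<in> {0..T}" and ex: "\<eta> \<le> \<bar>y \<sigma> - x \<sigma>\<bar>"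
          using \<sigma>(1) by (auto simp: X_def)
        have "\<bar>y \<sigma> - x \<sigma>\<bar> = w \<sigma> * \<bar>z \<sigma>\<bar>"
          using w_pos[of \<sigma>] by (simp add: yx abs_mult)
        also have "\<dots> \<le> W * (exp T * \<bar>y 0 - x 0\<bar>)"
        proof (intro mult_mono W \<sigma>T growth)
          show "\<bar>y \<tau> - x \<tau>\<bar> < \<eta>" if "0 < \<tau>" "\<tau> < \<sigma>" for \<tau>
            using \<sigma>(2)[of \<tau>] that \<sigma>T by (force simp: X_def)
        qed (use W1 in auto)
        also have "\<dots> < \<eta>"
          using close W1 by (simp add: d_def field_simps)
        finally show False
          using ex by simp
      qed
      show ?thesis
      proof (cases "T = 0")
        case True
        then show ?thesis
          using \<open>0 < e\<close> by (simp add: w0)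
      next
        case False
        then have "0 < T"
          using \<open>0 \<le> T\<close> by simp
        then obtain \<xi> where \<xi>: "0 < \<xi>" "\<xi> < T" "z T - z 0 = z' \<xi> * (T - 0)"
          by (rule mvt[OF _ contz z'[unfolded has_field_derivative_def]])
        have "\<bar>z' \<xi>\<bar> \<le> e' * (exp T * \<bar>y 0 - x 0\<bar>)"
          by (rule order_trans[OF z'_bound mult_left_mono[OF growth]])
             (use \<xi> e' stay in auto)
        then have "\<bar>z T - z 0\<bar> \<le> T * (e' * (exp T * \<bar>y 0 - x 0\<bar>))"
          using \<open>0 < T\<close> by (simp add: \<xi>(3) abs_mult)
        then have "w T * \<bar>z T - z 0\<bar> \<le> W * (T * (e' * (exp T * \<bar>y 0 - x 0\<bar>)))"
          using W1 W[of T] w_pos[of T] \<open>0 \<le> T\<close> by (intro mult_mono) auto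
        also have "\<dots> = (e' * (W * exp T * T)) * \<bar>y 0 - x 0\<bar>"
          by (simp add: mult_ac)
        also have "\<dots> \<le> e * \<bar>y 0 - x 0\<bar>"
          by (rule mult_right_mono[OF order_trans[OF mult_left_mono[OF M(2)] e'(3)]]) (use e'(1) in auto)
        finally show ?thesis
          using w_pos[of T]
          by (simp add: yx[of T] z0[symmetric] abs_mult flip: right_diff_distrib)
      qed
    qed
    ultimately show "\<exists>d>0. \<forall>y.
       (\<forall>\<tau>\<in>{0..T}. (y has_real_derivative f (y \<tau>)) (at \<tau> within {0..T})) \<longrightarrow>
       \<bar>y 0 - x 0\<bar> < d \<longrightarrow> \<bar>y T - x T - w T * (y 0 - x 0)\<bar> \<le> e * \<bar>y 0 - x 0\<bar>"
      by blast
  qed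
qed


section \<open>Transfer of derivatives along the flow\<close>

text \<open>A chain rule for \<open>h = \<phi> \<circ> g\<close> with \<open>\<phi>\<close> known only through its values on \<open>g ` S\<close>, and having
  derivative \<open>c\<close> at \<open>g u\<close> there: \<open>h - c g\<close> has derivative zero.\<close>

lemma has_derivative_of_linearised_values:
  fixes g h :: "'a::real_normed_vector \<Rightarrow> real"
  assumes g: "(g has_derivative D) (at u within S)" and "u \<in> S"
    and lin: "\<And>e. 0 < e \<Longrightarrow> \<exists>d>0. \<forall>v\<in>S. \<bar>g v - g u\<bar> < d \<longrightarrow>
      \<bar>h v - h u - c * (g v - g u)\<bar> \<le> e * \<bar>g v - g u\<bar>"
  shows "(h has_derivative (\<lambda>x. c * D x)) (at u within S)"
proof -
  obtain B where B: "0 < B" "\<And>x. \<bar>D x\<bar> \<le> norm x * B"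
    using bounded_linear.pos_bounded[OF has_derivative_bounded_linear[OF g]] by auto
  obtain d1 where d1: "0 < d1"
    "\<And>v. v \<in> S \<Longrightarrow> norm (v - u) < d1 \<Longrightarrow> \<bar>g v - g u - D (v - u)\<bar> \<le> norm (v - u)"
    using g unfolding has_derivative_within_alt real_norm_def
    by (metis mult_1 zero_less_one)
  have Lip: "\<bar>g v - g u\<bar> \<le> (B + 1) * norm (v - u)" if "v \<in> S" "norm (v - u) < d1" for v
    using d1(2)[OF that] B(2)[of "v - u"] by (simp add: algebra_simps)
  have "((\<lambda>v. h v - c * g v) has_derivative (\<lambda>x. 0)) (at u within S)"
    unfolding has_derivative_within_alt
  proof (intro conjI allI impI)
    show "bounded_linear (\<lambda>x::'a. 0::real)"
      by (rule bounded_linear_zero)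
    fix e :: real assume "0 < e"
    obtain d where d: "0 < d" "\<And>v. v \<in> S \<Longrightarrow> \<bar>g v - g u\<bar> < d \<Longrightarrow>
        \<bar>h v - h u - c * (g v - g u)\<bar> \<le> e / (B + 1) * \<bar>g v - g u\<bar>"
      using lin[of "e / (B + 1)"] \<open>0 < e\<close> B(1) by auto
    show "\<exists>d>0. \<forall>v\<in>S. norm (v - u) < d \<longrightarrow>
        norm (h v - c * g v - (h u - c * g u) - 0) \<le> e * norm (v - u)"
    proof (intro exI[of _ "min d1 (d / (B + 1))"] conjI ballI impI)
      show "0 < min d1 (d / (B + 1))"
        using d1 d B by simp
      fix v assume v: "v \<in> S" "norm (v - u) < min d1 (d / (B + 1))"
      then have L: "\<bar>g v - g u\<bar> \<le> (B + 1) * norm (v - u)"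
        by (intro Lip) auto
      also have "\<dots> < d"
        using v B(1) by (simp add: field_simps)
      finally have "\<bar>h v - h u - c * (g v - g u)\<bar> \<le> e / (B + 1) * \<bar>g v - g u\<bar>"
        using d(2) v(1) by blast
      also have "\<dots> \<le> e / (B + 1) * ((B + 1) * norm (v - u))"
        using L \<open>0 < e\<close> B(1) by (intro mult_left_mono) auto
      also have "\<dots> = e * norm (v - u)"
        using B(1) by simp
      finally show "norm (h v - c * g v - (h u - c * g u) - 0) \<le> e * norm (v - u)"
        by (simp add: algebra_simps)
    qed
  qed
  from has_derivative_add[OF this has_derivative_mult_right[OF g, of c]] show ?thesis
    by simp
qed

text \<open>The orbits are read from time \<open>s\<close> to time \<open>t\<close>, backwards if \<open>t < s\<close>. Reversing time replaces \<open>f\<close>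
  by \<open>- f\<close>, so both directions are covered by the sign \<open>\<sigma>\<close>.\<close>

lemma evolves_under_transfers_derivative:
  fixes r :: "real ^ 'n \<Rightarrow> real \<Rightarrow> real"
  assumes C1: "f C1_differentiable_on UNIV" and "is_interval I"
    and evol: "evolves_under f I r"
    and s: "s \<in> I" and t: "t \<in> I" and u: "u \<in> sphere 0 1"
    and D: "((\<lambda>v. r v s) has_derivative D) (at u within sphere 0 1)"
  obtains c where
    "((\<lambda>v. r v t) has_derivative (\<lambda>h. c * D h)) (at u within sphere 0 1)"
proof -
  obtain f' where f': "\<And>p. (f has_real_derivative f' p) (at p)" "continuous_on UNIV f'"
    using C1 unfolding C1_differentiable_on_def
    by (auto simp: has_real_derivative_iff_has_vector_derivative)
  define \<sigma> where "\<sigma> = (if s \<le> t then 1 else - 1 :: real)"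
  define T where "T = \<bar>t - s\<bar>"
  have T: "0 \<le> T" "s + \<sigma> * T = t"
    by (auto simp: T_def \<sigma>_def)
  have in_I: "s + \<sigma> * \<tau> \<in> I" if "\<tau> \<in> {0..T}" for \<tau>
  proof -
    have "min s t \<le> s + \<sigma> * \<tau>" "s + \<sigma> * \<tau> \<le> max s t"
      using that by (auto simp: T_def \<sigma>_def split: if_splits)
    moreover have "min s t \<in> I" "max s t \<in> I"
      using s t by (simp_all add: min_def max_def)
    ultimately show ?thesis
      using \<open>is_interval I\<close> unfolding is_interval_1 by blast
  qed
  have sol: "((\<lambda>\<tau>. r v (s + \<sigma> * \<tau>)) has_real_derivative \<sigma> * f (r v (s + \<sigma> * \<tau>)))
      (at \<tau> within {0..T})" if v: "v \<in> sphere 0 1" and \<tau>: "\<tau> \<in> {0..T}" for v \<tau>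
  proof -
    have "(r v has_real_derivative f (r v (s + \<sigma> * \<tau>)))
        (at (s + \<sigma> * \<tau>) within (\<lambda>\<tau>. s + \<sigma> * \<tau>) ` {0..T})"
      by (rule DERIV_subset[of _ _ _ I])
         (use evol v in_I[OF \<tau>] in_I in \<open>auto simp: evolves_under_def\<close>)
    moreover have "((\<lambda>\<tau>. s + \<sigma> * \<tau>) has_real_derivative \<sigma>) (at \<tau> within {0..T})"
      by (auto intro!: derivative_eq_intros)
    ultimately have "(r v \<circ> (\<lambda>\<tau>. s + \<sigma> * \<tau>) has_real_derivative f (r v (s + \<sigma> * \<tau>)) * \<sigma>)
        (at \<tau> within {0..T})"
      by (rule DERIV_image_chain)
    then show ?thesis
      by (simp only: o_def mult.commute[of \<sigma> "f _"])
  qed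
  obtain c where c:
    "\<And>e. 0 < e \<Longrightarrow> \<exists>d>0. \<forall>y.
       (\<forall>\<tau>\<in>{0..T}. (y has_real_derivative \<sigma> * f (y \<tau>)) (at \<tau> within {0..T})) \<longrightarrow>
       \<bar>y 0 - r u s\<bar> < d \<longrightarrow> \<bar>y T - r u t - c * (y 0 - r u s)\<bar> \<le> e * \<bar>y 0 - r u s\<bar>"
  proof (rule flow_linearisation[of "\<lambda>p. \<sigma> * f p" "\<lambda>p. \<sigma> * f' p" T "\<lambda>\<tau>. r u (s + \<sigma> * \<tau>)"])
    show "((\<lambda>p. \<sigma> * f p) has_real_derivative \<sigma> * f' p) (at p)" for p
      by (rule DERIV_cmult[OF f'(1)])
    show "continuous_on UNIV (\<lambda>p. \<sigma> * f' p)"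
      by (intro continuous_intros f'(2))
  qed (use T sol[OF u] in auto)
  have lin: "\<exists>d>0. \<forall>v\<in>sphere 0 1. \<bar>r v s - r u s\<bar> < d \<longrightarrow>
      \<bar>r v t - r u t - c * (r v s - r u s)\<bar> \<le> e * \<bar>r v s - r u s\<bar>" if e: "0 < e" for e
  proof -
    obtain d where "0 < d" and d: "\<And>y.
       (\<forall>\<tau>\<in>{0..T}. (y has_real_derivative \<sigma> * f (y \<tau>)) (at \<tau> within {0..T})) \<Longrightarrow>
       \<bar>y 0 - r u s\<bar> < d \<Longrightarrow> \<bar>y T - r u t - c * (y 0 - r u s)\<bar> \<le> e * \<bar>y 0 - r u s\<bar>"
      using c[OF e] by blast
    have "\<bar>r v t - r u t - c * (r v s - r u s)\<bar> \<le> e * \<bar>r v s - r u s\<bar>"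
      if "v \<in> sphere 0 1" "\<bar>r v s - r u s\<bar> < d" for v
      using d[of "\<lambda>\<tau>. r v (s + \<sigma> * \<tau>)"] sol[OF that(1)] that(2) by (simp add: T(2))
    with \<open>0 < d\<close> show ?thesis
      by blast
  qed
  show ?thesis
    by (rule that[OF has_derivative_of_linearised_values[OF D u]]) (use lin in auto)
qed

section \<open>Local extrema and critical points on the sphere\<close>

text \<open>A tangent vector at \<open>u\<close> is, up to scaling, the velocity at \<open>u\<close> of a great circle \<open>\<gamma>\<close>, and
  \<open>\<rho> \<circ> \<gamma>\<close> has a local minimum there.\<close>

lemma local_minimum_on_sphere_critical:
  fixes u :: "'a::real_inner"
  assumes D: "(\<rho> has_derivative D) (at u within sphere 0 1)"
    and u: "u \<in> sphere 0 1"
    and min: "\<forall>\<^sub>F v in at u within sphere 0 1. \<rho> u \<le> (\<rho> v :: real)"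
    and h: "h \<bullet> u = 0"
  shows "D h = 0"
proof (cases "h = 0")
  case True
  then show ?thesis
    using has_derivative_bounded_linear[OF D] by (simp add: bounded_linear.linear linear_0)
next
  case False
  define k where "k = h /\<^sub>R norm h"
  define \<gamma> where "\<gamma> a = cos a *\<^sub>R u + sin a *\<^sub>R k" for a :: real
  have \<gamma>_sphere: "\<gamma> a \<in> sphere 0 1" for a
  proof -
    have "\<gamma> a \<bullet> \<gamma> a = (cos a)\<^sup>2 * (u \<bullet> u) + (sin a)\<^sup>2 * (k \<bullet> k)"
      using h by (simp add: \<gamma>_def k_def inner_add inner_commute power2_eq_square)
    also have "\<dots> = 1"
      using u False by (simp add: k_def dot_square_norm power2_eq_square field_simps)
    finally show ?thesis
      by (simp add: norm_eq_1)
  qed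
  have \<gamma>0: "\<gamma> 0 = u"
    by (simp add: \<gamma>_def)
  have \<gamma>': "(\<gamma> has_derivative (\<lambda>a. a *\<^sub>R k)) (at 0)"
    unfolding \<gamma>_def by (rule derivative_eq_intros refl | simp)+
  have "((\<rho> \<circ> \<gamma>) has_derivative (D \<circ> (\<lambda>a. a *\<^sub>R k))) (at 0 within UNIV)"
    by (rule diff_chain_within[OF \<gamma>'])
       (use D \<gamma>_sphere in \<open>auto simp: \<gamma>0 intro: has_derivative_subset\<close>)
  moreover have "\<forall>\<^sub>F a in at 0. (\<rho> \<circ> \<gamma>) 0 \<le> (\<rho> \<circ> \<gamma>) a"
  proof -
    obtain d where d: "0 < d" "\<And>v. v \<in> sphere 0 1 \<Longrightarrow> dist v u < d \<Longrightarrow> \<rho> u \<le> \<rho> v"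
      using min unfolding eventually_at by (metis order_refl)
    have "(\<gamma> \<longlongrightarrow> u) (at 0)"
      using has_derivative_continuous[OF \<gamma>'] by (simp add: continuous_within \<gamma>0)
    then have "\<forall>\<^sub>F a in at 0. dist (\<gamma> a) u < d"
      using d(1) by (rule tendstoD)
    then show ?thesis
      by eventually_elim (use d(2) \<gamma>_sphere in \<open>auto simp: \<gamma>0\<close>)
  qed
  ultimately have "D \<circ> (\<lambda>a. a *\<^sub>R k) = (\<lambda>a. 0)"
    by (rule has_derivative_local_min)
  from fun_cong[OF this, of "norm h"] show ?thesis
    using False by (simp add: k_def)
qed

section \<open>Counting minima, maxima and saddles\<close>

lemma infinite_union_eqpoll_Plus:
  assumes "infinite (A \<union> B \<union> C)"
  shows "A \<union> B \<union> C \<approx> A <+> B <+> C"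
proof -
  define U where "U = A \<union> B \<union> C"
  have inf: "infinite U"
    using assms by (simp add: U_def)
  have self: "U <+> U \<approx> U"
    using card_of_Plus_infinite1[OF inf card_of_mono1[OF subset_refl]]
    by (simp add: eqpoll_iff_card_of_ordIso)
  have "A <+> B <+> C \<lesssim> U <+> U <+> U"
    by (intro sum_lepoll_mono subset_imp_lepoll) (auto simp: U_def)
  also have "U <+> U <+> U \<approx> U"
    using sum_eqpoll_cong[OF eqpoll_refl self] self eqpoll_trans by blast
  finally have "A <+> B <+> C \<lesssim> U" .
  moreover have "U \<lesssim> A <+> B <+> C"
    unfolding lepoll_def U_def
    by (rule exI[of _ "\<lambda>x. if x \<in> A then Inl x else if x \<in> B then Inr (Inl x) else Inr (Inr x)"])
       (auto simp: inj_on_def split: if_splits)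
  ultimately show ?thesis
    unfolding U_def by (rule lepoll_antisym[rotated])
qed

lemma disjoint_union_eqpoll_Plus:
  assumes "A \<inter> B = {}" "A \<inter> C = {}" "B \<inter> C = {}"
  shows "A \<union> B \<union> C \<approx> A <+> B <+> C"
  unfolding eqpoll_def
  by (rule exI[of _ "\<lambda>x. if x \<in> A then Inl x else if x \<in> B then Inr (Inl x) else Inr (Inr x)"])
     (use assms in \<open>auto simp: bij_betw_def inj_on_def image_iff split: if_splits\<close>)

text \<open>Near \<open>u\<close> the function is constant, so all points near \<open>u\<close> are local minima too, and the connected
  sphere has no isolated points. On the two-point sphere in dimension 1 this fails.\<close>

lemma minimum_and_maximum_imp_infinitely_many_minima:
  fixes \<rho> :: "real ^ 'n \<Rightarrow> real"
  assumes dim: "CARD('n) \<ge> 2"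
    and u: "u \<in> sphere_local_minima \<rho>" "u \<in> sphere_local_maxima \<rho>"
  shows "infinite (sphere_local_minima \<rho>)"
proof -
  have uS: "u \<in> sphere 0 1"
    using u(1) by (simp add: sphere_local_minima_def)
  have "\<forall>\<^sub>F v in at u within sphere 0 1. \<rho> v = \<rho> u"
    using u unfolding sphere_local_minima_def sphere_local_maxima_def
    by (auto elim: eventually_elim2)
  then obtain d where d: "0 < d" "\<And>v. v \<in> sphere 0 1 \<Longrightarrow> dist v u < d \<Longrightarrow> \<rho> v = \<rho> u"
    unfolding eventually_at by metis
  have "sphere 0 1 \<inter> ball u d \<subseteq> sphere_local_minima \<rho>"
  proof
    fix v assume v: "v \<in> sphere 0 1 \<inter> ball u d"
    have "\<forall>\<^sub>F x in at v within sphere 0 1. x \<in> sphere 0 1 \<and> x \<in> ball u d"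
      using v by (auto intro: eventually_at_in_open' eventually_conj simp: eventually_at_filter
          intro!: eventually_nhds_in_open eventually_mono[OF eventually_nhds_in_open[of "ball u d" v]])
    then have "\<forall>\<^sub>F x in at v within sphere 0 1. \<rho> v \<le> \<rho> x"
      by eventually_elim (use v d(2) in \<open>auto simp: dist_commute\<close>)
    then show "v \<in> sphere_local_minima \<rho>"
      using v by (simp add: sphere_local_minima_def)
  qed
  moreover have "u islimpt sphere 0 1"
  proof (rule connected_imp_perfect[OF connected_sphere uS])
    show "2 \<le> DIM(real ^ 'n)"
      using dim by simp
    have "u \<noteq> 0"
      using uS by auto
    then have "u + u \<noteq> 0"
      by (simp flip: scaleR_2)
    then have "- u \<in> sphere 0 1" "u \<noteq> - u"
      using uS by (auto simp: eq_neg_iff_add_eq_0)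
    then show "sphere 0 1 \<noteq> {x}" for x :: "real ^ 'n"
      using uS by (metis singletonD)
  qed
  then have "infinite (sphere 0 1 \<inter> ball u d)"
    using d(1) by (simp add: islimpt_eq_infinite_ball)
  ultimately show ?thesis
    using finite_subset by blast
qed

lemma sphere_critical_points_eqpoll_extrema_and_saddles:
  fixes \<rho> :: "real ^ 'n \<Rightarrow> real"
  assumes dim: "CARD('n) \<ge> 2"
    and diff: "\<And>u. u \<in> sphere 0 1 \<Longrightarrow> \<exists>D. (\<rho> has_derivative D) (at u within sphere 0 1)"
  shows "sphere_critical_points \<rho> \<approx>
    sphere_local_minima \<rho> <+> sphere_local_maxima \<rho> <+> sphere_saddles \<rho>"
proof -
  have min: "sphere_local_minima \<rho> \<subseteq> sphere_critical_points \<rho>"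
    using local_minimum_on_sphere_critical diff
    unfolding sphere_local_minima_def sphere_critical_points_def by blast
  have max: "sphere_local_maxima \<rho> \<subseteq> sphere_critical_points \<rho>"
  proof
    fix u assume u: "u \<in> sphere_local_maxima \<rho>"
    then have uS: "u \<in> sphere 0 1"
      by (simp add: sphere_local_maxima_def)
    then obtain D where D: "(\<rho> has_derivative D) (at u within sphere 0 1)"
      using diff by blast
    have "D h = 0" if "h \<bullet> u = 0" for h
      using local_minimum_on_sphere_critical[OF has_derivative_minus[OF D] uS _ that] u
      by (simp add: sphere_local_maxima_def)
    with D uS show "u \<in> sphere_critical_points \<rho>"
      by (auto simp: sphere_critical_points_def)
  qed
  have union: "sphere_critical_points \<rho> =
      sphere_local_minima \<rho> \<union> sphere_local_maxima \<rho> \<union> sphere_saddles \<rho>"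
    using min max by (auto simp: sphere_saddles_def)
  show ?thesis
  proof (cases "sphere_local_minima \<rho> \<inter> sphere_local_maxima \<rho> = {}")
    case True
    then show ?thesis
      unfolding union by (intro disjoint_union_eqpoll_Plus) (auto simp: sphere_saddles_def)
  next
    case False
    then have "infinite (sphere_local_minima \<rho>)"
      using minimum_and_maximum_imp_infinitely_many_minima[OF dim] by blast
    then show ?thesis
      unfolding union by (intro infinite_union_eqpoll_Plus) simp
  qed
qed

section \<open>Invariance of the number of critical points\<close>

lemma Ck_on_Suc_imp_differentiable:
  assumes "Ck_on (Suc k) S g" "u \<in> S"
  shows "\<exists>D. (g has_derivative D) (at u within S)"
proof -
  obtain U g' where U: "open U" "u \<in> U" "Ck_on_open (Suc k) U g'" "\<forall>v\<in>S \<inter> U. g' v = g v"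
    using bspec[OF assms(1)[unfolded Ck_on_def] assms(2)] by (elim exE conjE)
  obtain D where D: "(g' has_derivative D) (at u)"
    using U(3)[unfolded Ck_on_open.simps, THEN conjunct1, rule_format, OF U(2)]
    unfolding differentiable_def by (elim exE)
  obtain d where d: "0 < d" "ball u d \<subseteq> U"
    using U(1,2) by (meson openE)
  have "(g has_derivative D) (at u within S)"
    by (rule has_derivative_transform_within[OF has_derivative_at_withinI[OF D] d(1) assms(2)])
       (use U(4) d(2) in \<open>auto simp: dist_commute subset_iff\<close>)
  then show ?thesis
    by (rule exI[of _ D])
qed

theorem theorem3:
  fixes f :: "real \<Rightarrow> real"
    and r :: "real ^ 'n \<Rightarrow> real \<Rightarrow> real"
    and I :: "real set"
  assumes "CARD('n) \<ge> 2"
    and "f C1_differentiable_on UNIV"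
    and "is_interval I" and "0 \<in> I"
    and "evolves_under f I r"
    and "Ck_on 3 (sphere 0 1) (\<lambda>u. r u 0)"
  shows "(\<forall>s\<in>I. \<forall>t\<in>I. sphere_critical_points (\<lambda>u. r u s) \<approx> sphere_critical_points (\<lambda>u. r u t)) \<and>
         (\<forall>t\<in>I. sphere_critical_points (\<lambda>u. r u t) \<approx>
            sphere_local_minima (\<lambda>u. r u t) <+> sphere_local_maxima (\<lambda>u. r u t) <+>
            sphere_saddles (\<lambda>u. r u t))"
proof (intro conjI ballI)
  note transfer = evolves_under_transfers_derivative[OF assms(2,3,5)]
  have persist: "sphere_critical_points (\<lambda>u. r u s) \<subseteq> sphere_critical_points (\<lambda>u. r u t)"
    if st: "s \<in> I" "t \<in> I" for s t
  proof
    fix u assume "u \<in> sphere_critical_points (\<lambda>u. r u s)"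
    then obtain D where u: "u \<in> sphere 0 1" and
      D: "((\<lambda>v. r v s) has_derivative D) (at u within sphere 0 1)" "\<And>h. h \<bullet> u = 0 \<Longrightarrow> D h = 0"
      by (auto simp: sphere_critical_points_def)
    obtain c where "((\<lambda>v. r v t) has_derivative (\<lambda>h. c * D h)) (at u within sphere 0 1)"
      using transfer[OF st u D(1)] by blast
    with u D(2) show "u \<in> sphere_critical_points (\<lambda>u. r u t)"
      by (auto simp: sphere_critical_points_def intro!: exI[of _ "\<lambda>h. c * D h"])
  qed
  show "sphere_critical_points (\<lambda>u. r u s) \<approx> sphere_critical_points (\<lambda>u. r u t)"
    if "s \<in> I" "t \<in> I" for s t
  proof -
    have "sphere_critical_points (\<lambda>u. r u s) = sphere_critical_points (\<lambda>u. r u t)"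
      using persist that by blast
    then show ?thesis
      by (simp add: eqpoll_refl)
  qed
  show "sphere_critical_points (\<lambda>u. r u t) \<approx>
      sphere_local_minima (\<lambda>u. r u t) <+> sphere_local_maxima (\<lambda>u. r u t) <+>
      sphere_saddles (\<lambda>u. r u t)" if t: "t \<in> I" for t
  proof (rule sphere_critical_points_eqpoll_extrema_and_saddles[OF assms(1)])
    fix u :: "real ^ 'n" assume u: "u \<in> sphere 0 1"
    have "Ck_on (Suc 2) (sphere 0 1) (\<lambda>u. r u 0)"
      using assms(6) by (simp del: One_nat_def)
    then obtain D where "((\<lambda>v. r v 0) has_derivative D) (at u within sphere 0 1)"
      using Ck_on_Suc_imp_differentiable[OF _ u] by blast
    then show "\<exists>D. ((\<lambda>v. r v t) has_derivative D) (at u within sphere 0 1)"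
      using transfer[OF assms(4) t u] by blast
  qed
qed

end
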